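(* Let $m$ be a positive integer and let $G$ be a graph on $n$ vertices containing no induced subgraph isomorphic to $K_{1,m+1}$. Let $(x,y)$ be an $\left(\frac{m-1}{m}\right)$-max edge of $G$ with $d=\deg(x)\ge\deg(y)=e$. Then \[\operatorname{pd}(G)\le n\left(1-\frac{1}{d+\frac{m-1}{m}e+1}\right).\]
   Context: All graphs are finite and simple. For a scalar $\alpha>0$, an edge $(x,y)$ of $G$ (with its endpoints listed in this order) is called $\alpha$-max if it maximizes the quantity $\deg(x)+\alpha\deg(y)$ over all edges of $G$ and both orderings of their endpoints. $K_{1,m+1}$ is the complete bipartite graph with one vertex on one side and $m+1$ on the other. For $G$ with vertex set $\{x_1,\dots,x_n\}$ and a fixed field $\mathbf{k}$, $S=\mathbf{k}[x_1,\dots,x_n]$, $I(G)=(x_ix_j:(x_i,x_j)\in E(G))$ is the edge ideal, and $\operatorname{pd}(G)$ is the projective dimension of $S/I(G)$. *)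

theory Defs
  imports Complex_Main "HOL-Library.Poly_Mapping"
begin

text \<open>The polynomial ring S = k[x_v : v a vertex], with monomials represented as
  finitely supported exponent vectors (finitely supported maps v to nat).\<close>
type_synonym ('v, 'k) mpoly = "('v \<Rightarrow>\<^sub>0 nat) \<Rightarrow>\<^sub>0 'k"

definition Var :: "'v \<Rightarrow> ('v, 'k::field) mpoly" where
  "Var v = Poly_Mapping.single (Poly_Mapping.single v 1) 1"

definition simple_graph :: "('v \<Rightarrow> 'v \<Rightarrow> bool) \<Rightarrow> bool" where
  "simple_graph E \<longleftrightarrow> (\<forall>u v. E u v \<longrightarrow> E v u) \<and> (\<forall>u. \<not> E u u)"

definition deg :: "('v::finite \<Rightarrow> 'v \<Rightarrow> bool) \<Rightarrow> 'v \<Rightarrow> nat" where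
  "deg E v = card {w. E v w}"

definition alpha_max_edge :: "real \<Rightarrow> ('v::finite \<Rightarrow> 'v \<Rightarrow> bool) \<Rightarrow> 'v \<Rightarrow> 'v \<Rightarrow> bool" where
  "alpha_max_edge \<alpha> E x y \<longleftrightarrow> E x y \<and>
     (\<forall>u w. E u w \<longrightarrow> real (deg E u) + \<alpha> * real (deg E w) \<le> real (deg E x) + \<alpha> * real (deg E y))"

definition has_induced_star :: "('v \<Rightarrow> 'v \<Rightarrow> bool) \<Rightarrow> nat \<Rightarrow> bool" where
  "has_induced_star E k \<longleftrightarrow> (\<exists>c L. finite L \<and> card L = k \<and> c \<notin> L \<and> (\<forall>l\<in>L. E c l) \<and>
      (\<forall>a\<in>L. \<forall>b\<in>L. \<not> E a b))"

definition edge_ideal :: "('v::finite \<Rightarrow> 'v \<Rightarrow> bool) \<Rightarrow> ('v, 'k::field) mpoly set" where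
  "edge_ideal E = {(\<Sum>p\<in>{(u,v). E u v}. c p * Var (fst p) * Var (snd p)) | c. True}"

definition free_mod :: "nat \<Rightarrow> (nat \<Rightarrow> ('v, 'k::field) mpoly) set" where
  "free_mod r = {f. \<forall>j\<ge>r. f j = 0}"

definition mat_app :: "nat \<Rightarrow> nat \<Rightarrow> (nat \<Rightarrow> nat \<Rightarrow> ('v, 'k::field) mpoly)
     \<Rightarrow> (nat \<Rightarrow> ('v, 'k) mpoly) \<Rightarrow> (nat \<Rightarrow> ('v, 'k) mpoly)" where
  "mat_app rows cols A f = (\<lambda>i. if i < rows then (\<Sum>j<cols. A i j * f j) else 0)"

text \<open>A finite free resolution of S/I of length p:
  0 \<rightarrow> F_p \<rightarrow> ... \<rightarrow> F_1 \<rightarrow> F_0 = S \<rightarrow> S/I \<rightarrow> 0, with F_i = S^(b i),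
  d_i : F_i \<rightarrow> F_(i-1) given by the matrix M i, F_i = 0 for i > p.\<close>
definition free_resolution ::
  "('v, 'k::field) mpoly set \<Rightarrow> nat \<Rightarrow> (nat \<Rightarrow> nat) \<Rightarrow> (nat \<Rightarrow> nat \<Rightarrow> nat \<Rightarrow> ('v, 'k) mpoly) \<Rightarrow> bool" where
  "free_resolution I p b M \<longleftrightarrow>
     b 0 = 1 \<and> (\<forall>i>p. b i = 0) \<and>
     {mat_app (b 0) (b 1) (M 1) f 0 | f. f \<in> free_mod (b 1)} = I \<and>
     (\<forall>i\<ge>1. {f \<in> free_mod (b i). mat_app (b (i - 1)) (b i) (M i) f = (\<lambda>_. 0)} =
             {mat_app (b i) (b (Suc i)) (M (Suc i)) g | g. g \<in> free_mod (b (Suc i))})"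

definition proj_dim_quot :: "('v, 'k::field) mpoly set \<Rightarrow> nat" where
  "proj_dim_quot I = (LEAST p. \<exists>b M. free_resolution I p b M)"

definition pd_graph :: "('v::finite \<Rightarrow> 'v \<Rightarrow> bool) \<Rightarrow> 'k::field itself \<Rightarrow> nat" where
  "pd_graph E K = proj_dim_quot (edge_ideal E :: ('v, 'k) mpoly set)"

end

theory Submission
  imports Defs "HOL-Library.Function_Algebras" "HOL-Analysis.Product_Vector"
begin

text \<open>
  Write \<open>\<alpha> = (m - 1) / m\<close> and \<open>D = d + \<alpha> e + 1\<close>. For every vertex \<open>y\<close> the edge ideal satisfies
  \<open>pd(G) \<le> max (pd(G - y) + 1) (pd(G - N[y]) + deg y)\<close>, because \<open>I(G)\<close> is the sum of \<open>I(G - y)\<close> and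
  \<open>y (I(G) : y)\<close>, which meet in \<open>y I(G - y)\<close>. The bound \<open>pd(H) \<le> |H| (1 - 1/D)\<close> follows
  by induction over all induced subgraphs \<open>H\<close>: take a vertex \<open>v\<close> that is not isolated
  and delete its neighbours one at a time, after which \<open>v\<close> is isolated and can be dropped for free.
  The term coming from \<open>N[y]\<close> for the \<open>i\<close>-th deleted neighbour \<open>y\<close> is harmless as long as
  \<open>i\<close> plus the current degree of \<open>y\<close> is at most \<open>D\<close>. This holds if at most \<open>\<alpha> deg v\<close> of the vertices
  deleted before \<open>y\<close> are not adjacent to \<open>y\<close>. Such an order exists, chosen from the last vertex
  backwards: a set \<open>A\<close> of neighbours of \<open>v\<close> has no independent subset of size \<open>m + 1\<close>, so a maximal
  independent subset dominates \<open>A\<close> with at most \<open>m\<close> closed neighbourhoods, one of which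
  contains at least \<open>|A| / m\<close> elements.
\<close>

section \<open>Finite free resolutions of modules\<close>

definition scale_fun :: "'a::times \<Rightarrow> ('i \<Rightarrow> 'a) \<Rightarrow> 'i \<Rightarrow> 'a" where
  "scale_fun r f = (\<lambda>i. r * f i)"

text \<open>A copy of \<^locale>\<open>module\<close>: whatever is added to that locale itself is also exported, without
  qualification, by its interpretation for real vector spaces, which would shadow the original.\<close>

locale cring_module = module scale
  for scale :: "'a::comm_ring_1 \<Rightarrow> 'b::ab_group_add \<Rightarrow> 'b" (infixr "*s" 75)

sublocale module_hom \<subseteq> m1: cring_module s1 ..

sublocale module_hom \<subseteq> m2: cring_module s2 ..

sublocale module_pair \<subseteq> m1: cring_module s1 ..

sublocale module_pair \<subseteq> m2: cring_module s2 ..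

sublocale module_prod \<subseteq> p: cring_module scale ..

interpretation tuple: cring_module "scale_fun :: 'a::comm_ring_1 \<Rightarrow> ('i \<Rightarrow> 'a) \<Rightarrow> 'i \<Rightarrow> 'a"
  by standard (simp_all add: scale_fun_def fun_eq_iff algebra_simps)

definition tuples :: "nat \<Rightarrow> (nat \<Rightarrow> 'a::zero) set" where
  "tuples n = {f. \<forall>j\<ge>n. f j = 0}"

definition tuple_append :: "nat \<Rightarrow> (nat \<Rightarrow> 'b) \<Rightarrow> (nat \<Rightarrow> 'b) \<Rightarrow> nat \<Rightarrow> 'b" where
  "tuple_append n f g = (\<lambda>j. if j < n then f j else g (j - n))"

definition tuple_drop :: "nat \<Rightarrow> (nat \<Rightarrow> 'b) \<Rightarrow> nat \<Rightarrow> 'b" where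
  "tuple_drop n f = (\<lambda>j. f (j + n))"

lemma subspace_tuples: "tuple.subspace (tuples n)"
  by (auto simp: tuple.subspace_def tuples_def scale_fun_def)

lemma module_hom_tuple_drop:
  "module_hom scale_fun scale_fun (tuple_drop n :: (nat \<Rightarrow> 'a::comm_ring_1) \<Rightarrow> _)"
  by unfold_locales (auto simp: tuple_drop_def scale_fun_def)

lemma tuple_drop_append [simp]: "tuple_drop n (tuple_append n f g) = g"
  by (simp add: tuple_drop_def tuple_append_def)

lemma image_tuple_append: "tuple_append n f g ` {..<n + k} = f ` {..<n} \<union> g ` {..<k}"
proof -
  have "{..<n + k} = {..<n} \<union> (\<lambda>j. j + n) ` {..<k}"
    by (simp add: lessThan_atLeast0 image_add_atLeastLessThan' ivl_disj_un_two(3) add.commute)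
  then show ?thesis by (simp only: image_Un image_image) (simp add: tuple_append_def)
qed

lemma tuple_append_in_tuples: "g \<in> tuples k \<Longrightarrow> tuple_append n f g \<in> tuples (n + k)"
  by (simp add: tuple_append_def tuples_def)

lemma tuple_drop_in_tuples: "h \<in> tuples (n + k) \<Longrightarrow> tuple_drop n h \<in> tuples k"
  by (simp add: tuple_drop_def tuples_def)

lemma tuple_drop_eq_0_iff: "tuple_drop n h = 0 \<longleftrightarrow> h \<in> tuples n"
  by (auto simp: tuple_drop_def tuples_def fun_eq_iff) (metis le_add_diff_inverse2)

lemma tuples_mono: "n \<le> k \<Longrightarrow> tuples n \<subseteq> tuples k"
  by (auto simp: tuples_def)

context cring_module
begin

definition lincomb :: "'i set \<Rightarrow> ('i \<Rightarrow> 'b) \<Rightarrow> ('i \<Rightarrow> 'a) \<Rightarrow> 'b" where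
  "lincomb I a f = (\<Sum>i\<in>I. f i *s a i)"

definition syzygies :: "nat \<Rightarrow> (nat \<Rightarrow> 'b) \<Rightarrow> (nat \<Rightarrow> 'a) set" where
  "syzygies n a = {f \<in> tuples n. lincomb {..<n} a f = 0}"

lemma module_hom_lincomb: "module_hom scale_fun scale (lincomb I a)"
  by unfold_locales
    (simp_all add: lincomb_def scale_fun_def scale_left_distrib sum.distrib scale_sum_right)

lemma subspace_syzygies: "tuple.subspace (syzygies n a)"
proof -
  interpret lincomb: module_hom scale_fun scale "lincomb {..<n} a" by (rule module_hom_lincomb)
  show ?thesis
    using tuple.subspace_inter[OF subspace_tuples lincomb.subspace_kernel]
    by (simp add: syzygies_def Collect_conj_eq)
qed

lemma lincomb_cong:
  "(\<And>i. i \<in> I \<Longrightarrow> a i = b i) \<Longrightarrow> (\<And>i. i \<in> I \<Longrightarrow> f i = g i) \<Longrightarrow> lincomb I a f = lincomb I b g"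
  by (simp add: lincomb_def)

lemma lincomb_in_span: "(\<And>i. i \<in> I \<Longrightarrow> a i \<in> span S) \<Longrightarrow> lincomb I a f \<in> span S"
  unfolding lincomb_def by (intro span_sum span_scale)

lemma span_image_eq_range_lincomb:
  assumes "finite I"
  shows "span (a ` I) = range (lincomb I a)"
proof
  interpret lincomb: module_hom scale_fun scale "lincomb I a" by (rule module_hom_lincomb)
  show "span (a ` I) \<subseteq> range (lincomb I a)"
  proof (rule span_minimal)
    show "a ` I \<subseteq> range (lincomb I a)"
    proof
      fix x assume "x \<in> a ` I"
      then obtain i where "i \<in> I" "x = a i" by blast
      then have "x = lincomb I a (\<lambda>j. if j = i then 1 else 0)"
        using assms by (simp add: lincomb_def if_distrib[where f = "\<lambda>r. r *s _"] cong: if_cong)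
      then show "x \<in> range (lincomb I a)" by blast
    qed
    show "subspace (range (lincomb I a))"
      by (rule lincomb.subspace_image) (rule tuple.subspace_UNIV)
  qed
  show "range (lincomb I a) \<subseteq> span (a ` I)"
    by (auto intro: lincomb_in_span span_base)
qed

lemma span_image_eq_lincomb_tuples: "span (a ` {..<n}) = lincomb {..<n} a ` tuples n"
proof -
  have "lincomb {..<n} a f \<in> lincomb {..<n} a ` tuples n" for f
  proof
    show "lincomb {..<n} a f = lincomb {..<n} a (\<lambda>j. if j < n then f j else 0)"
      by (rule lincomb_cong) auto
  qed (simp add: tuples_def)
  then show ?thesis by (auto simp: span_image_eq_range_lincomb)
qed

lemma lincomb_tuple_append:
  "lincomb {..<n + k} (tuple_append n a b) h =
    lincomb {..<n} a h + lincomb {..<k} b (tuple_drop n h)"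
  by (induction k) (simp_all add: lincomb_def tuple_append_def tuple_drop_def add_ac)

lemma lincomb_tuple_append_coeffs [simp]:
  "lincomb {..<n} a (tuple_append n f g) = lincomb {..<n} a f"
  by (rule lincomb_cong) (auto simp: tuple_append_def)

end

text \<open>\<open>has_free_res p M\<close> asks for \<open>p\<close> free modules, so that it bounds the projective dimension of
  a nonzero \<open>M\<close> by \<open>p - 1\<close>. Syzygies are tuples whatever the type of \<open>M\<close>, hence only the first
  step of the recursion is polymorphic.\<close>

primrec tuple_has_free_res :: "nat \<Rightarrow> (nat \<Rightarrow> 'a::comm_ring_1) set \<Rightarrow> bool" where
  "tuple_has_free_res 0 M \<longleftrightarrow> M = {0}"
| "tuple_has_free_res (Suc p) M \<longleftrightarrow>
     (\<exists>n a. tuple.span (a ` {..<n}) = M \<and> tuple_has_free_res p (tuple.syzygies n a))"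

definition (in cring_module) has_free_res :: "nat \<Rightarrow> 'b set \<Rightarrow> bool" where
  "has_free_res p M \<longleftrightarrow> (case p of 0 \<Rightarrow> M = {0}
     | Suc q \<Rightarrow> \<exists>n a. span (a ` {..<n}) = M \<and> tuple_has_free_res q (syzygies n a))"

lemma tuple_has_free_res_iff: "tuple_has_free_res p M \<longleftrightarrow> tuple.has_free_res p M"
  by (cases p) (simp_all add: tuple.has_free_res_def)

context cring_module
begin

lemma has_free_res_0: "has_free_res 0 M \<longleftrightarrow> M = {0}"
  by (simp add: has_free_res_def)

lemma has_free_res_Suc:
  "has_free_res (Suc p) M \<longleftrightarrow>
     (\<exists>n a. span (a ` {..<n}) = M \<and> tuple.has_free_res p (syzygies n a))"
  by (simp add: has_free_res_def tuple_has_free_res_iff)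

lemma subspace_has_free_res: "has_free_res p M \<Longrightarrow> subspace M"
  by (cases p) (auto simp: has_free_res_0 has_free_res_Suc)

lemma has_free_res_Suc_0_zero: "has_free_res (Suc 0) {0}"
proof -
  have "span (a ` {..<0}) = {0}" "syzygies 0 a = {0}" for a
    by (auto simp: syzygies_def lincomb_def tuples_def)
  then show ?thesis
    unfolding has_free_res_Suc tuple.has_free_res_0 by blast
qed

end

lemma tuple_has_free_res_Suc_mono:
  fixes M :: "(nat \<Rightarrow> 'a::comm_ring_1) set"
  shows "tuple.has_free_res p M \<Longrightarrow> tuple.has_free_res (Suc p) M"
proof (induction p arbitrary: M)
  case 0
  then show ?case by (simp add: tuple.has_free_res_0 tuple.has_free_res_Suc_0_zero)
next
  case (Suc p)
  then show ?case by (metis tuple.has_free_res_Suc)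
qed

context cring_module
begin

lemma has_free_res_Suc_mono: "has_free_res p M \<Longrightarrow> has_free_res (Suc p) M"
proof (cases p)
  case 0
  then show "has_free_res p M \<Longrightarrow> ?thesis"
    by (simp add: has_free_res_0 has_free_res_Suc_0_zero)
next
  case (Suc q)
  then show "has_free_res p M \<Longrightarrow> ?thesis"
    by (metis has_free_res_Suc tuple_has_free_res_Suc_mono)
qed

lemma has_free_res_mono: "has_free_res p M \<Longrightarrow> p \<le> q \<Longrightarrow> has_free_res q M"
  by (induction q) (auto simp: le_Suc_eq has_free_res_Suc_mono)

lemma has_free_res_zero: "has_free_res p {0}"
  by (rule has_free_res_mono[of 0]) (simp_all add: has_free_res_0)

lemma syzygies_append_Int_kernel_drop:
  "{h \<in> syzygies (n + k) (tuple_append n a b). tuple_drop n h = 0} = syzygies n a"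
proof -
  have "lincomb {..<n + k} (tuple_append n a b) h = lincomb {..<n} a h"
    if "tuple_drop n h = 0" for h
    using that unfolding lincomb_tuple_append by (simp add: lincomb_def)
  then show ?thesis
    using tuples_mono[of n "n + k"] by (auto simp: syzygies_def tuple_drop_eq_0_iff)
qed

end

context module_hom
begin

lemma hom_lincomb: "f (m1.lincomb I a g) = m2.lincomb I (f \<circ> a) g"
  by (simp add: m1.lincomb_def m2.lincomb_def sum scale)

lemma span_append_generators:
  assumes "m1.subspace M" "m1.span (a ` {..<n}) = {x \<in> M. f x = 0}"
    and "b ` {..<k} \<subseteq> M" "m2.span ((f \<circ> b) ` {..<k}) = f ` M"
  shows "m1.span (tuple_append n a b ` {..<n + k}) = M"
proof -
  have "m1.span (a ` {..<n} \<union> b ` {..<k}) = M"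
  proof (rule m1.span_subspace[OF _ _ assms(1)])
    show "a ` {..<n} \<union> b ` {..<k} \<subseteq> M"
      using assms(2,3) m1.span_superset[of "a ` {..<n}"] by auto
    show "M \<subseteq> m1.span (a ` {..<n} \<union> b ` {..<k})"
    proof
      fix x assume "x \<in> M"
      then have "f x \<in> f ` m1.span (b ` {..<k})"
        unfolding span_image[symmetric] image_comp assms(4) by (rule imageI)
      then obtain y where y: "y \<in> m1.span (b ` {..<k})" "f x = f y" by blast
      then have "y \<in> M"
        using m1.span_minimal[OF assms(3,1)] by blast
      with y have "x - y \<in> m1.span (a ` {..<n})"
        using assms(1,2) \<open>x \<in> M\<close> by (simp add: m1.subspace_diff diff)
      with y have "(x - y) + y \<in> m1.span (a ` {..<n} \<union> b ` {..<k})"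
        unfolding m1.span_Un by blast
      then show "x \<in> m1.span (a ` {..<n} \<union> b ` {..<k})" by simp
    qed
  qed
  then show ?thesis by (simp only: image_tuple_append)
qed

lemma drop_image_syzygies_append:
  assumes "m1.subspace M" "m1.span (a ` {..<n}) = {x \<in> M. f x = 0}" "b ` {..<k} \<subseteq> M"
  shows "tuple_drop n ` m1.syzygies (n + k) (tuple_append n a b) = m2.syzygies k (f \<circ> b)"
proof (intro equalityI subsetI)
  fix h assume "h \<in> tuple_drop n ` m1.syzygies (n + k) (tuple_append n a b)"
  then obtain g where g: "g \<in> tuples (n + k)" "h = tuple_drop n g"
      "m1.lincomb {..<n} a g + m1.lincomb {..<k} b h = 0"
    by (auto simp: m1.syzygies_def m1.lincomb_tuple_append)
  have "m1.lincomb {..<n} a g \<in> m1.span (a ` {..<n})"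
    by (simp add: m1.span_image_eq_range_lincomb)
  then have "f (m1.lincomb {..<n} a g) = 0" using assms(2) by blast
  then have "f (m1.lincomb {..<k} b h) = 0"
    using arg_cong[OF g(3), of f] by (simp add: add)
  with g show "h \<in> m2.syzygies k (f \<circ> b)"
    by (simp add: m2.syzygies_def hom_lincomb tuple_drop_in_tuples)
next
  fix h assume h: "h \<in> m2.syzygies k (f \<circ> b)"
  have "m1.lincomb {..<k} b h \<in> m1.span (b ` {..<k})"
    by (simp add: m1.span_image_eq_range_lincomb)
  then have "m1.lincomb {..<k} b h \<in> M"
    using m1.span_minimal[OF assms(3,1)] by blast
  then have "- m1.lincomb {..<k} b h \<in> m1.span (a ` {..<n})"
    using h assms(1,2) by (simp add: m2.syzygies_def m1.subspace_neg neg hom_lincomb)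
  then obtain g where "m1.lincomb {..<n} a g = - m1.lincomb {..<k} b h"
    by (auto simp: m1.span_image_eq_range_lincomb)
  with h have "tuple_append n g h \<in> m1.syzygies (n + k) (tuple_append n a b)"
    by (simp add: m1.syzygies_def m2.syzygies_def m1.lincomb_tuple_append tuple_append_in_tuples)
  then show "h \<in> tuple_drop n ` m1.syzygies (n + k) (tuple_append n a b)"
    by (metis imageI tuple_drop_append)
qed

lemma has_free_res_image_obtain_lifts:
  assumes "m2.has_free_res (Suc p) (f ` M)"
  obtains k b where "b ` {..<k} \<subseteq> M" "m2.span ((f \<circ> b) ` {..<k}) = f ` M"
    "tuple.has_free_res p (m2.syzygies k (f \<circ> b))"
proof -
  from assms obtain k c where c: "m2.span (c ` {..<k}) = f ` M"
      "tuple.has_free_res p (m2.syzygies k c)"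
    by (auto simp: m2.has_free_res_Suc)
  then have "\<forall>j<k. \<exists>x\<in>M. f x = c j"
    using m2.span_superset[of "c ` {..<k}"] by fastforce
  then obtain b where b: "b j \<in> M" "f (b j) = c j" if "j < k" for j by metis
  have "(f \<circ> b) ` {..<k} = c ` {..<k}" "m2.syzygies k (f \<circ> b) = m2.syzygies k c"
    by (auto simp: b m2.syzygies_def m2.lincomb_def)
  with b c show thesis by (intro that[of b k]) auto
qed

text \<open>The horseshoe lemma for the generators; the claim for the syzygies is a hypothesis because the
  induction on \<open>p\<close> can only be carried out at the type of tuples.\<close>

lemma has_free_res_Suc_extension:
  assumes syzygies: "\<And>(\<phi> :: (nat \<Rightarrow> 'a) \<Rightarrow> nat \<Rightarrow> 'a) N.
      module_hom scale_fun scale_fun \<phi> \<Longrightarrow> tuple.subspace N \<Longrightarrow>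
      tuple.has_free_res p {g \<in> N. \<phi> g = 0} \<Longrightarrow> tuple.has_free_res p (\<phi> ` N) \<Longrightarrow>
      tuple.has_free_res p N"
    and M: "m1.subspace M"
    and kernel: "m1.has_free_res (Suc p) {x \<in> M. f x = 0}"
    and image: "m2.has_free_res (Suc p) (f ` M)"
  shows "m1.has_free_res (Suc p) M"
proof -
  from kernel obtain n a where a: "m1.span (a ` {..<n}) = {x \<in> M. f x = 0}"
      "tuple.has_free_res p (m1.syzygies n a)"
    by (auto simp: m1.has_free_res_Suc)
  from image obtain k b where b: "b ` {..<k} \<subseteq> M" "m2.span ((f \<circ> b) ` {..<k}) = f ` M"
      "tuple.has_free_res p (m2.syzygies k (f \<circ> b))"
    by (rule has_free_res_image_obtain_lifts)
  have "tuple.has_free_res p (m1.syzygies (n + k) (tuple_append n a b))"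
  proof (rule syzygies[OF module_hom_tuple_drop m1.subspace_syzygies])
    show "tuple.has_free_res p {h \<in> m1.syzygies (n + k) (tuple_append n a b). tuple_drop n h = 0}"
      using a by (simp only: m1.syzygies_append_Int_kernel_drop)
    show "tuple.has_free_res p (tuple_drop n ` m1.syzygies (n + k) (tuple_append n a b))"
      using b by (simp only: drop_image_syzygies_append[OF M a(1) b(1)])
  qed
  with span_append_generators[OF M a(1) b(1,2)] show ?thesis
    by (auto simp: m1.has_free_res_Suc)
qed

lemma has_free_res_0_extension:
  assumes "m1.has_free_res 0 {x \<in> M. f x = 0}" "m2.has_free_res 0 (f ` M)"
  shows "m1.has_free_res 0 M"
  using assms by (auto simp: m1.has_free_res_0 m2.has_free_res_0)

end

lemma tuple_has_free_res_extension:
  fixes \<phi> :: "(nat \<Rightarrow> 'a::comm_ring_1) \<Rightarrow> nat \<Rightarrow> 'a"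
  assumes "module_hom scale_fun scale_fun \<phi>" "tuple.subspace M"
    and "tuple.has_free_res p {g \<in> M. \<phi> g = 0}" "tuple.has_free_res p (\<phi> ` M)"
  shows "tuple.has_free_res p M"
  using assms
proof (induction p arbitrary: M \<phi>)
  case 0
  show ?case by (rule module_hom.has_free_res_0_extension[OF 0(1,3,4)])
next
  case (Suc p)
  show ?case by (rule module_hom.has_free_res_Suc_extension[OF Suc.prems(1) Suc.IH Suc.prems(2-4)])
qed

context module_hom
begin

lemma has_free_res_extension:
  assumes "m1.subspace M" "m1.has_free_res p {x \<in> M. f x = 0}" "m2.has_free_res p (f ` M)"
  shows "m1.has_free_res p M"
proof (cases p)
  case 0
  show ?thesis unfolding 0 by (rule has_free_res_0_extension[OF assms(2,3)[unfolded 0]])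
next
  case (Suc q)
  show ?thesis unfolding Suc
    by (rule has_free_res_Suc_extension[OF tuple_has_free_res_extension assms[unfolded Suc]])
qed

lemma has_free_res_quotient:
  assumes "m1.has_free_res (Suc p) M" "m1.has_free_res p {x \<in> M. f x = 0}"
  shows "m2.has_free_res (Suc p) (f ` M)"
proof -
  from assms(1) obtain n a where a: "m1.span (a ` {..<n}) = M"
      "tuple.has_free_res p (m1.syzygies n a)"
    by (auto simp: m1.has_free_res_Suc)
  interpret lincomb: module_hom scale_fun s1 "m1.lincomb {..<n} a"
    by (rule m1.module_hom_lincomb)
  have image: "m2.span ((f \<circ> a) ` {..<n}) = f ` M"
    by (simp only: a(1) span_image flip: image_comp)
  have "tuple.has_free_res p (m2.syzygies n (f \<circ> a))"
  proof (rule lincomb.has_free_res_extension[OF m2.subspace_syzygies])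
    have "{g \<in> m2.syzygies n (f \<circ> a). m1.lincomb {..<n} a g = 0} = m1.syzygies n a"
      by (auto simp: m1.syzygies_def m2.syzygies_def simp flip: hom_lincomb)
    with a(2) show "tuple.has_free_res p {g \<in> m2.syzygies n (f \<circ> a). m1.lincomb {..<n} a g = 0}"
      by simp
    have "m1.lincomb {..<n} a ` m2.syzygies n (f \<circ> a) = {x \<in> M. f x = 0}"
      unfolding a(1)[symmetric] m1.span_image_eq_lincomb_tuples
      by (auto simp: m2.syzygies_def simp flip: hom_lincomb)
    with assms(2) show "m1.has_free_res p (m1.lincomb {..<n} a ` m2.syzygies n (f \<circ> a))"
      by simp
  qed
  with image show ?thesis unfolding m2.has_free_res_Suc by (intro exI conjI)
qed

lemma has_free_res_inj_image:
  assumes "m1.has_free_res p M" "\<And>x. x \<in> M \<Longrightarrow> f x = 0 \<Longrightarrow> x = 0"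
  shows "m2.has_free_res p (f ` M)"
proof (cases p)
  case 0
  with assms(1) show ?thesis by (simp add: m1.has_free_res_0 m2.has_free_res_0)
next
  case (Suc q)
  have "0 \<in> M"
    using m1.subspace_has_free_res[OF assms(1)] by (rule m1.subspace_0)
  then have "{x \<in> M. f x = 0} = {0}"
    using assms(2) by auto
  then have "m1.has_free_res q {x \<in> M. f x = 0}"
    by (simp only: m1.has_free_res_zero)
  with assms(1) show ?thesis
    unfolding Suc by (rule has_free_res_quotient)
qed

end

lemma (in module_prod) has_free_res_Times:
  assumes "m1.has_free_res p A" "m2.has_free_res p B"
  shows "p.has_free_res p (A \<times> B)"
proof -
  interpret snd: module_hom scale s2 snd by (rule module_hom_snd)
  have inl: "module_hom s1 scale (\<lambda>x. (x, 0))"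
    by unfold_locales (simp_all add: scale_def)
  note A = m1.subspace_has_free_res[OF assms(1)] and B = m2.subspace_has_free_res[OF assms(2)]
  show ?thesis
  proof (rule snd.has_free_res_extension[OF subspace_Times[OF A B]])
    have "{z \<in> A \<times> B. snd z = 0} = (\<lambda>x. (x, 0)) ` A"
      using m2.subspace_0[OF B] by (auto simp: image_iff)
    also have "p.has_free_res p \<dots>"
      using inl assms(1) by (rule module_hom.has_free_res_inj_image) (simp add: zero_prod_def)
    finally show "p.has_free_res p {z \<in> A \<times> B. snd z = 0}" .
    have "snd ` (A \<times> B) = B"
      using m1.subspace_0[OF A] by auto
    with assms(2) show "m2.has_free_res p (snd ` (A \<times> B))" by simp
  qed
qed

context cring_module
begin

lemma has_free_res_span_Un:
  assumes "has_free_res (Suc p) (span A)" "has_free_res (Suc p) (span B)"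
    and "has_free_res p (span A \<inter> span B)"
  shows "has_free_res (Suc p) (span (A \<union> B))"
proof -
  interpret P: module_prod scale scale ..
  interpret add: module_hom P.scale scale "\<lambda>(x, y). x + y"
    by unfold_locales (auto simp: P.scale_def algebra_simps)
  interpret antidiagonal: module_hom scale P.scale "\<lambda>x. (x, - x)"
    by unfold_locales (auto simp: P.scale_def)
  have "{z \<in> span A \<times> span B. (\<lambda>(x, y). x + y) z = 0} = (\<lambda>x. (x, - x)) ` (span A \<inter> span B)"
  proof (intro equalityI subsetI)
    fix z assume "z \<in> {z \<in> span A \<times> span B. (\<lambda>(x, y). x + y) z = 0}"
    then obtain x where "z = (x, - x)" "x \<in> span A" "- x \<in> span B"
      by (auto simp: add_eq_0_iff)
    with span_neg[of "- x" B] show "z \<in> (\<lambda>x. (x, - x)) ` (span A \<inter> span B)" by simp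
  qed (auto intro: span_neg)
  moreover have "P.p.has_free_res p ((\<lambda>x. (x, - x)) ` (span A \<inter> span B))"
    using assms(3) by (rule antidiagonal.has_free_res_inj_image) (simp add: zero_prod_def)
  ultimately have "has_free_res (Suc p) ((\<lambda>(x, y). x + y) ` (span A \<times> span B))"
    using assms(1,2) by (intro add.has_free_res_quotient P.has_free_res_Times) simp_all
  moreover have "(\<lambda>(x, y). x + y) ` (span A \<times> span B) = span (A \<union> B)"
    by (auto simp: span_Un)
  ultimately show ?thesis by simp
qed

end

lemma free_mod_eq_tuples: "free_mod n = tuples n"
  by (simp add: free_mod_def tuples_def)

definition diff_kernel ::
  "(nat \<Rightarrow> nat) \<Rightarrow> (nat \<Rightarrow> nat \<Rightarrow> nat \<Rightarrow> ('v, 'k::field) mpoly) \<Rightarrow> nat \<Rightarrow>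
    (nat \<Rightarrow> ('v, 'k) mpoly) set" where
  "diff_kernel b M i = {f \<in> free_mod (b i). mat_app (b (i - 1)) (b i) (M i) f = (\<lambda>_. 0)}"

definition diff_image ::
  "(nat \<Rightarrow> nat) \<Rightarrow> (nat \<Rightarrow> nat \<Rightarrow> nat \<Rightarrow> ('v, 'k::field) mpoly) \<Rightarrow> nat \<Rightarrow>
    (nat \<Rightarrow> ('v, 'k) mpoly) set" where
  "diff_image b M i = {mat_app (b (i - 1)) (b i) (M i) f | f. f \<in> free_mod (b i)}"

definition exact_complex ::
  "nat \<Rightarrow> (nat \<Rightarrow> nat) \<Rightarrow> (nat \<Rightarrow> nat \<Rightarrow> nat \<Rightarrow> ('v, 'k::field) mpoly) \<Rightarrow> bool" where
  "exact_complex p b M \<longleftrightarrow> (\<forall>i>p. b i = 0) \<and> (\<forall>i\<ge>1. diff_kernel b M i = diff_image b M (Suc i))"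

lemma free_resolution_iff:
  "free_resolution I p b M \<longleftrightarrow> b 0 = 1 \<and> exact_complex p b M \<and> (\<lambda>f. f 0) ` diff_image b M 1 = I"
  by (auto simp: free_resolution_def exact_complex_def diff_kernel_def diff_image_def
      setcompr_eq_image image_image)

lemma tuple_lincomb_apply: "tuple.lincomb I a f i = (\<Sum>j\<in>I. f j * a j i)"
  unfolding tuple.lincomb_def
  by (induction I rule: infinite_finite_induct) (simp_all add: scale_fun_def)

lemma mat_app_eq_lincomb:
  assumes "tuple.span (a ` {..<n}) \<subseteq> free_mod r"
  shows "mat_app r n (\<lambda>i j. a j i) f = tuple.lincomb {..<n} a f"
proof
  fix i
  have "tuple.lincomb {..<n} a f \<in> free_mod r"
    using assms by (auto simp: tuple.span_image_eq_range_lincomb)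
  then show "mat_app r n (\<lambda>i j. a j i) f i = tuple.lincomb {..<n} a f i"
    by (auto simp: mat_app_def free_mod_def tuple_lincomb_apply mult.commute)
qed

lemma exact_complex_prepend:
  assumes exact: "exact_complex p b M"
    and syzygies: "diff_image b M 1 = tuple.syzygies (b 0) a"
    and generators: "tuple.span (a ` {..<b 0}) \<subseteq> free_mod r"
  obtains b' M' where "exact_complex (Suc p) b' M'" "b' 0 = r"
    "diff_image b' M' 1 = tuple.span (a ` {..<b 0})"
proof
  define b' where "b' = case_nat r b"
  define M' where "M' = (\<lambda>i. if i = 1 then \<lambda>k j. a j k else M (i - 1))"
  show "b' 0 = r" by (simp add: b'_def)
  show "diff_image b' M' 1 = tuple.span (a ` {..<b 0})"
    by (simp add: diff_image_def b'_def M'_def mat_app_eq_lincomb[OF generators]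
        tuple.span_image_eq_lincomb_tuples free_mod_eq_tuples setcompr_eq_image)
  have "diff_kernel b' M' 1 = tuple.syzygies (b 0) a"
    by (simp add: diff_kernel_def b'_def M'_def mat_app_eq_lincomb[OF generators]
        tuple.syzygies_def free_mod_eq_tuples zero_fun_def)
  moreover have "diff_image b' M' (Suc (Suc i)) = diff_image b M (Suc i)" for i
    by (simp add: diff_image_def b'_def M'_def)
  moreover have "diff_kernel b' M' (Suc (Suc i)) = diff_kernel b M (Suc i)" for i
    by (simp add: diff_kernel_def b'_def M'_def)
  ultimately have "diff_kernel b' M' (Suc i) = diff_image b' M' (Suc (Suc i))" for i
    using exact syzygies by (cases i) (simp_all add: exact_complex_def)
  then have "\<forall>i\<ge>1. diff_kernel b' M' i = diff_image b' M' (Suc i)"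
    by (metis One_nat_def Suc_le_D)
  then show "exact_complex (Suc p) b' M'"
    using exact by (auto simp: exact_complex_def b'_def split: nat.split)
qed

lemma exact_complex_of_has_free_res:
  assumes "tuple.has_free_res p N" "N \<subseteq> free_mod r"
  shows "\<exists>b M. exact_complex p b M \<and> b 0 = r \<and> diff_image b M 1 = N"
  using assms
proof (induction p arbitrary: N r)
  case 0
  have "exact_complex 0 (\<lambda>i. if i = 0 then r else 0) (\<lambda>_ _ _. 0)"
    "diff_image (\<lambda>i. if i = 0 then r else 0) (\<lambda>_ _ _. 0) 1 = N"
    using 0
    by (auto simp: exact_complex_def diff_kernel_def diff_image_def mat_app_def free_mod_def
        tuple.has_free_res_0 zero_fun_def fun_eq_iff intro!: exI[of _ "\<lambda>_. 0"])
  then show ?case by force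
next
  case (Suc p)
  then obtain n a where a: "tuple.span (a ` {..<n}) = N"
      "tuple.has_free_res p (tuple.syzygies n a)"
    by (auto simp: tuple.has_free_res_Suc)
  have "tuple.syzygies n a \<subseteq> free_mod n"
    by (auto simp: tuple.syzygies_def free_mod_eq_tuples)
  with Suc.IH[OF a(2)] obtain b M where bM: "exact_complex p b M" "b 0 = n"
      "diff_image b M 1 = tuple.syzygies n a"
    by blast
  obtain b' M' where "exact_complex (Suc p) b' M'" "b' 0 = r" "diff_image b' M' 1 = N"
    by (rule exact_complex_prepend[of p b M a r]) (use a(1) bM Suc.prems(2) in auto)
  then show ?case by blast
qed

interpretation ideal: cring_module "(*) :: 'a::comm_ring_1 \<Rightarrow> 'a \<Rightarrow> 'a"
  by standard (auto simp: algebra_simps)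

\<comment> \<open>As a rewrite rule it reassociates products to the left and loops with \<open>mult.assoc\<close>.\<close>
declare ideal.scale_scale [simp del]

lemma proj_dim_quot_le:
  assumes "ideal.has_free_res p J"
  shows "proj_dim_quot J \<le> p"
proof -
  define \<iota> :: "('a, 'b) mpoly \<Rightarrow> nat \<Rightarrow> ('a, 'b) mpoly" where "\<iota> = (\<lambda>x i. if i = 0 then x else 0)"
  have hom: "module_hom (*) scale_fun \<iota>"
    by unfold_locales (auto simp: \<iota>_def scale_fun_def fun_eq_iff)
  have "x = 0" if "\<iota> x = 0" for x
    using fun_cong[OF that, of 0] by (simp add: \<iota>_def)
  then have "tuple.has_free_res p (\<iota> ` J)"
    using module_hom.has_free_res_inj_image[OF hom assms] by blast
  moreover have "\<iota> ` J \<subseteq> free_mod 1"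
    by (simp add: image_subset_iff \<iota>_def free_mod_def)
  ultimately obtain b M where "exact_complex p b M" "b 0 = 1" "diff_image b M 1 = \<iota> ` J"
    using exact_complex_of_has_free_res[of p "\<iota> ` J" 1] by auto
  then have "free_resolution J p b M"
    by (simp add: free_resolution_iff image_image \<iota>_def)
  then show ?thesis
    unfolding proj_dim_quot_def by (intro Least_le) blast
qed

section \<open>Division by a variable\<close>

lemma poly_mapping_induct_monomials [case_names zero single add]:
  fixes f :: "'b \<Rightarrow>\<^sub>0 'c::comm_monoid_add"
  assumes "P 0" "\<And>m c. P (Poly_Mapping.single m c)" "\<And>f g. P f \<Longrightarrow> P g \<Longrightarrow> P (f + g)"
  shows "P f"
proof (induction f rule: Poly_Mapping.update_induct)
  case (update f m c)
  have "Poly_Mapping.update m c f = f + Poly_Mapping.single m c"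
    using update(1)
    by (intro poly_mapping_eqI) (auto simp: lookup_update lookup_add lookup_single in_keys_iff)
  then show ?case using assms update by simp
qed (use assms in simp)

text \<open>The quotient of the division by a variable: monomials not divisible by it are dropped.\<close>

definition var_quot :: "'v \<Rightarrow> ('v, 'k::field) mpoly \<Rightarrow> ('v, 'k) mpoly" where
  "var_quot z = Poly_Mapping.map_key ((+) (Poly_Mapping.single z 1))"

definition lacks_var :: "'v \<Rightarrow> ('v, 'k::field) mpoly \<Rightarrow> bool" where
  "lacks_var z f \<longleftrightarrow> (\<forall>m\<in>Poly_Mapping.keys f. Poly_Mapping.lookup m z = 0)"

lemma inj_plus_monomial: "inj ((+) (m :: 'v \<Rightarrow>\<^sub>0 nat))"
  by (simp add: inj_def)

lemma lookup_var_quot: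
  "Poly_Mapping.lookup (var_quot z f) m = Poly_Mapping.lookup f (Poly_Mapping.single z 1 + m)"
  unfolding var_quot_def by (simp add: map_key.rep_eq[OF inj_plus_monomial])

lemma var_quot_add: "var_quot z (f + g) = var_quot z f + var_quot z g"
  unfolding var_quot_def by (rule map_key_plus[OF inj_plus_monomial])

lemma var_quot_Var_times: "var_quot z (Var z * f) = f"
proof (induction f rule: poly_mapping_induct_monomials)
  case zero
  show ?case by (simp add: var_quot_def map_key_zero[OF inj_plus_monomial])
next
  case (single m c)
  show ?case
    using map_key_single[OF inj_plus_monomial, of "Poly_Mapping.single z 1" m c]
    by (simp add: var_quot_def Var_def mult_single)
next
  case (add f g)
  then show ?case by (simp add: distrib_left var_quot_add)
qed

lemma Var_times_eq_0: "Var z * f = 0 \<Longrightarrow> f = 0"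
  by (metis mult_zero_right var_quot_Var_times)

lemma monomial_divisible_by_var:
  assumes "Poly_Mapping.lookup m z \<noteq> (0::nat)"
  obtains m' where "m = Poly_Mapping.single z 1 + m'"
proof
  show "m = Poly_Mapping.single z 1 + (m - Poly_Mapping.single z 1)"
    using assms
    by (intro poly_mapping_eqI) (auto simp: lookup_add lookup_minus lookup_single when_def)
qed

lemma lacks_var_iff_var_quot: "lacks_var z f \<longleftrightarrow> var_quot z f = 0"
proof
  assume "lacks_var z f"
  then have "Poly_Mapping.single z 1 + m \<notin> Poly_Mapping.keys f" for m
    by (auto simp: lacks_var_def lookup_add)
  then show "var_quot z f = 0"
    by (intro poly_mapping_eqI) (simp add: lookup_var_quot in_keys_iff)
next
  assume quot: "var_quot z f = 0"
  show "lacks_var z f"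
    unfolding lacks_var_def
  proof (intro ballI, rule ccontr)
    fix m assume m: "m \<in> Poly_Mapping.keys f" "Poly_Mapping.lookup m z \<noteq> 0"
    then obtain m' where "m = Poly_Mapping.single z 1 + m'"
      by (elim monomial_divisible_by_var)
    with m show False
      using lookup_var_quot[of z f m'] by (simp add: quot in_keys_iff)
  qed
qed

lemma lacks_var_Var: "u \<noteq> z \<Longrightarrow> lacks_var z (Var u)"
  by (simp add: lacks_var_def Var_def lookup_single)

lemma lacks_var_mult: "lacks_var z f \<Longrightarrow> lacks_var z g \<Longrightarrow> lacks_var z (f * g)"
  using keys_mult[of f g] by (force simp: lacks_var_def lookup_add)

lemma var_quot_mult_lacks_var:
  assumes "lacks_var z g"
  shows "var_quot z (f * g) = var_quot z f * g"
proof -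
  define r where "r = f - Var z * var_quot z f"
  have f: "f = Var z * var_quot z f + r" by (simp add: r_def)
  have "var_quot z f = var_quot z f + var_quot z r"
    using arg_cong[OF f, of "var_quot z"] by (simp add: var_quot_add var_quot_Var_times)
  then have "lacks_var z r" by (simp add: lacks_var_iff_var_quot)
  with assms have "var_quot z (r * g) = 0"
    by (simp add: lacks_var_mult flip: lacks_var_iff_var_quot)
  have "f * g = Var z * (var_quot z f * g) + r * g"
    by (subst f) (simp add: algebra_simps)
  then show ?thesis
    using \<open>var_quot z (r * g) = 0\<close> by (simp add: var_quot_add var_quot_Var_times)
qed

lemma var_quot_in_span:
  assumes "\<And>b. b \<in> B \<Longrightarrow> lacks_var z b" "f \<in> ideal.span B"
  shows "var_quot z f \<in> ideal.span B"
  using assms(2)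
proof (induction rule: ideal.span_induct_alt)
  case base
  then show ?case
    using ideal.span_zero by (simp add: var_quot_def map_key_zero[OF inj_plus_monomial])
next
  case (step c b f)
  then show ?case
    by (auto simp: var_quot_add var_quot_mult_lacks_var assms(1)
        intro: ideal.span_add ideal.span_scale ideal.span_base)
qed

lemma span_Int_Var_times:
  assumes "\<And>b. b \<in> B \<Longrightarrow> lacks_var z b" "ideal.span B \<subseteq> J"
  shows "ideal.span B \<inter> (*) (Var z) ` J = (*) (Var z) ` ideal.span B"
proof (intro equalityI subsetI)
  fix f assume "f \<in> ideal.span B \<inter> (*) (Var z) ` J"
  then obtain g where g: "f = Var z * g" "f \<in> ideal.span B" by blast
  then have "g \<in> ideal.span B"
    using var_quot_in_span[OF assms(1) g(2)] by (simp add: var_quot_Var_times)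
  then show "f \<in> (*) (Var z) ` ideal.span B" using g by blast
qed (use assms(2) in \<open>auto intro: ideal.span_scale\<close>)

lemma ideal_module_hom_times: "module_hom (*) (*) ((*) (z :: 'a::comm_ring_1))"
  by unfold_locales (simp_all add: algebra_simps)

lemma ideal_has_free_res_UNIV: "ideal.has_free_res (Suc p) (UNIV :: 'a::comm_ring_1 set)"
proof -
  have "ideal.span ((\<lambda>_. 1 :: 'a) ` {..<1::nat}) = UNIV"
    by (simp add: lessThan_Suc ideal.span_singleton)
  moreover have "ideal.syzygies 1 (\<lambda>_. 1 :: 'a) = {0}"
    by (auto simp: ideal.syzygies_def ideal.lincomb_def tuples_def fun_eq_iff)
      (metis One_nat_def Suc_leI gr0I)
  ultimately show ?thesis
    unfolding ideal.has_free_res_Suc using tuple.has_free_res_zero by metis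
qed

lemma ideal_has_free_res_span_Un_Var_times:
  assumes "\<And>b. b \<in> B \<Longrightarrow> lacks_var z b" "ideal.span B \<subseteq> ideal.span T"
    and "ideal.has_free_res p (ideal.span B)" "ideal.has_free_res (Suc p) (ideal.span T)"
  shows "ideal.has_free_res (Suc p) (ideal.span (B \<union> (*) (Var z) ` T))"
proof -
  have times: "ideal.has_free_res q ((*) (Var z) ` J)" if "ideal.has_free_res q J" for q J
    using ideal_module_hom_times that Var_times_eq_0 by (rule module_hom.has_free_res_inj_image)
  have span_times: "ideal.span ((*) (Var z) ` T) = (*) (Var z) ` ideal.span T"
    by (rule module_hom.span_image[OF ideal_module_hom_times])
  have span_Int: "ideal.span B \<inter> (*) (Var z) ` ideal.span T = (*) (Var z) ` ideal.span B"
    using assms(1,2) by (rule span_Int_Var_times)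
  show ?thesis
  proof (rule ideal.has_free_res_span_Un)
    show "ideal.has_free_res (Suc p) (ideal.span B)"
      using assms(3) by (rule ideal.has_free_res_Suc_mono)
    show "ideal.has_free_res (Suc p) (ideal.span ((*) (Var z) ` T))"
      unfolding span_times using assms(4) by (rule times)
    show "ideal.has_free_res p (ideal.span B \<inter> ideal.span ((*) (Var z) ` T))"
      unfolding span_times span_Int using assms(3) by (rule times)
  qed
qed

lemma ideal_has_free_res_span_insert_Var:
  assumes "\<And>b. b \<in> B \<Longrightarrow> lacks_var z b" "ideal.has_free_res p (ideal.span B)"
  shows "ideal.has_free_res (Suc p) (ideal.span (insert (Var z) B))"
proof -
  have "ideal.span {1} = (UNIV :: ('a, 'b) mpoly set)"
    by (simp add: ideal.span_singleton)
  then have "ideal.has_free_res (Suc p) (ideal.span (B \<union> (*) (Var z) ` {1}))"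
    using assms
    by (intro ideal_has_free_res_span_Un_Var_times) (auto intro: ideal_has_free_res_UNIV)
  then show ?thesis by simp
qed

section \<open>Edge ideals of induced subgraphs\<close>

definition edge_monomials :: "('v \<Rightarrow> 'v \<Rightarrow> bool) \<Rightarrow> 'v set \<Rightarrow> ('v, 'k::field) mpoly set" where
  "edge_monomials E W = {Var u * Var v | u v. u \<in> W \<and> v \<in> W \<and> E u v}"

definition neighbours :: "('v \<Rightarrow> 'v \<Rightarrow> bool) \<Rightarrow> 'v set \<Rightarrow> 'v \<Rightarrow> 'v set" where
  "neighbours E W v = {w \<in> W. E v w}"

lemma finite_neighbours [simp]: "finite W \<Longrightarrow> finite (neighbours E W v)"
  by (simp add: neighbours_def)

text \<open>These monomials generate the colon ideal \<open>I(W) : x\<close>.\<close>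

definition colon_generators :: "('v \<Rightarrow> 'v \<Rightarrow> bool) \<Rightarrow> 'v set \<Rightarrow> 'v \<Rightarrow> ('v, 'k::field) mpoly set" where
  "colon_generators E W x =
     edge_monomials E (W - insert x (neighbours E W x)) \<union> Var ` neighbours E W x"

lemma lacks_var_edge_monomials: "z \<notin> W \<Longrightarrow> b \<in> edge_monomials E W \<Longrightarrow> lacks_var z b"
  by (auto simp: edge_monomials_def intro!: lacks_var_mult lacks_var_Var)

lemma span_edge_monomials_delete_subset_colon:
  "ideal.span (edge_monomials E (W - {x})) \<subseteq> ideal.span (colon_generators E W x)"
proof (rule ideal.span_minimal[OF _ ideal.subspace_span], rule subsetI)
  let ?N = "neighbours E W x"
  fix f :: "('a, 'b) mpoly" assume "f \<in> edge_monomials E (W - {x})"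
  then obtain u v where uv: "f = Var u * Var v" "u \<in> W - {x}" "v \<in> W - {x}" "E u v"
    by (auto simp: edge_monomials_def)
  consider "u \<in> ?N" | "v \<in> ?N" | "u \<notin> ?N" "v \<notin> ?N" by blast
  then show "f \<in> ideal.span (colon_generators E W x)"
  proof cases
    case 1
    then have "Var v * Var u \<in> ideal.span (colon_generators E W x)"
      by (intro ideal.span_scale ideal.span_base) (simp add: colon_generators_def)
    then show ?thesis by (simp add: uv mult.commute)
  next
    case 2
    then show ?thesis
      unfolding uv by (intro ideal.span_scale ideal.span_base) (simp add: colon_generators_def)
  next
    case 3
    then have "f \<in> edge_monomials E (W - insert x ?N)"
      using uv by (auto simp: edge_monomials_def)
    then show ?thesis by (intro ideal.span_base) (simp add: colon_generators_def)
  qed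
qed

lemma edge_monomials_subset_vertex:
  assumes "simple_graph E"
  shows "edge_monomials E W \<subseteq> edge_monomials E (W - {x}) \<union> (*) (Var x) ` colon_generators E W x"
proof
  fix f :: "('a, 'b) mpoly" assume "f \<in> edge_monomials E W"
  then obtain u v where uv: "f = Var u * Var v" "u \<in> W" "v \<in> W" "E u v"
    by (auto simp: edge_monomials_def)
  show "f \<in> edge_monomials E (W - {x}) \<union> (*) (Var x) ` colon_generators E W x"
  proof (cases "u = x \<or> v = x")
    case True
    then obtain w where "w \<in> neighbours E W x" "f = Var x * Var w"
      using uv assms by (auto simp: neighbours_def simple_graph_def mult.commute)
    then show ?thesis by (auto simp: colon_generators_def)
  next
    case False
    with uv show ?thesis by (auto simp: edge_monomials_def)
  qed
qed

lemma span_edge_monomials_vertex: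
  assumes "simple_graph E" "x \<in> W"
  shows "ideal.span (edge_monomials E W :: ('v, 'k::field) mpoly set) =
    ideal.span (edge_monomials E (W - {x}) \<union> (*) (Var x) ` colon_generators E W x)"
    (is "ideal.span ?I = ideal.span ?G")
  unfolding ideal.span_eq
proof (intro conjI)
  show "?I \<subseteq> ideal.span ?G"
    using edge_monomials_subset_vertex[OF assms(1)] ideal.span_superset by (rule subset_trans)
  show "?G \<subseteq> ideal.span ?I"
  proof
    fix f assume "f \<in> ?G"
    then consider "f \<in> edge_monomials E (W - {x})"
      | v where "v \<in> neighbours E W x" "f = Var x * Var v"
      | g where "g \<in> edge_monomials E (W - insert x (neighbours E W x))" "f = Var x * g"
      by (auto simp: colon_generators_def)
    then show "f \<in> ideal.span ?I"
    proof cases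
      case 1
      then show ?thesis by (intro ideal.span_base) (auto simp: edge_monomials_def)
    next
      case 2
      then show ?thesis
        using assms(2) by (intro ideal.span_base) (auto simp: edge_monomials_def neighbours_def)
    next
      case 3
      then have "g \<in> ?I" by (auto simp: edge_monomials_def)
      then show ?thesis unfolding 3 by (intro ideal.span_scale ideal.span_base)
    qed
  qed
qed

lemma ideal_has_free_res_edge_monomials_Un_Var:
  assumes "finite Z" "Z \<inter> W = {}"
    and "ideal.has_free_res p (ideal.span (edge_monomials E W :: ('v, 'k::field) mpoly set))"
  shows "ideal.has_free_res (p + card Z)
    (ideal.span (edge_monomials E W \<union> Var ` Z :: ('v, 'k) mpoly set))"
  using assms
proof (induction Z rule: finite_induct)
  case (insert z Z)
  have "lacks_var z b" if "b \<in> edge_monomials E W \<union> Var ` Z" for b :: "('v, 'k) mpoly"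
    using that insert by (auto intro: lacks_var_edge_monomials lacks_var_Var)
  then have "ideal.has_free_res (Suc (p + card Z))
      (ideal.span (insert (Var z) (edge_monomials E W \<union> Var ` Z) :: ('v, 'k) mpoly set))"
    using insert by (intro ideal_has_free_res_span_insert_Var) auto
  then show ?case using insert by simp
qed simp

lemma ideal_has_free_res_vertex:
  assumes "simple_graph E" "finite W" "x \<in> W"
    and deletion: "ideal.has_free_res p
      (ideal.span (edge_monomials E (W - {x}) :: ('v, 'k::field) mpoly set))"
    and link: "ideal.has_free_res q
      (ideal.span (edge_monomials E (W - insert x (neighbours E W x)) :: ('v, 'k) mpoly set))"
    and "q + card (neighbours E W x) \<le> Suc p"
  shows "ideal.has_free_res (Suc p) (ideal.span (edge_monomials E W :: ('v, 'k) mpoly set))"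
  unfolding span_edge_monomials_vertex[OF assms(1,3)]
proof (rule ideal_has_free_res_span_Un_Var_times)
  have "ideal.has_free_res (q + card (neighbours E W x))
      (ideal.span (colon_generators E W x :: ('v, 'k) mpoly set))"
    unfolding colon_generators_def using assms(2) link
    by (intro ideal_has_free_res_edge_monomials_Un_Var) auto
  then show "ideal.has_free_res (Suc p) (ideal.span (colon_generators E W x :: ('v, 'k) mpoly set))"
    using assms(6) by (rule ideal.has_free_res_mono)
  show "lacks_var x b" if "b \<in> edge_monomials E (W - {x})" for b :: "('v, 'k) mpoly"
    using _ that by (rule lacks_var_edge_monomials) simp
qed (rule span_edge_monomials_delete_subset_colon deletion)+

lemma edge_ideal_eq_span:
  "(edge_ideal E :: ('v::finite, 'k::field) mpoly set) = ideal.span (edge_monomials E UNIV)"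
proof -
  let ?g = "\<lambda>p. Var (fst p) * Var (snd p) :: ('v, 'k) mpoly"
  have "edge_monomials E UNIV = ?g ` {(u, v). E u v}"
    by (force simp: edge_monomials_def)
  then have "ideal.span (edge_monomials E UNIV) = range (ideal.lincomb {(u, v). E u v} ?g)"
    by (simp add: ideal.span_image_eq_range_lincomb)
  then show ?thesis
    by (auto simp: edge_ideal_def ideal.lincomb_def mult.assoc)
qed

text \<open>The free modules in a resolution of an ideal \<open>J\<close> are those of the quotient by \<open>J\<close> in positive
  homological degree, so \<open>has_free_res p J\<close> bounds the projective dimension of the quotient by \<open>p\<close>.\<close>

definition induced_pd_le ::
  "'k::field itself \<Rightarrow> ('v \<Rightarrow> 'v \<Rightarrow> bool) \<Rightarrow> 'v set \<Rightarrow> real \<Rightarrow> bool" where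
  "induced_pd_le K E W s \<longleftrightarrow>
     (\<exists>p. real p \<le> s \<and>
       ideal.has_free_res p (ideal.span (edge_monomials E W :: ('v, 'k) mpoly set)))"

lemma pd_graph_le:
  fixes E :: "'v::finite \<Rightarrow> 'v \<Rightarrow> bool"
  assumes "induced_pd_le TYPE('k::field) E UNIV s"
  shows "real (pd_graph E TYPE('k)) \<le> s"
proof -
  from assms obtain p where p: "real p \<le> s"
      "ideal.has_free_res p (edge_ideal E :: ('v, 'k) mpoly set)"
    by (auto simp: induced_pd_le_def edge_ideal_eq_span)
  have "pd_graph E TYPE('k) \<le> p"
    unfolding pd_graph_def using p(2) by (rule proj_dim_quot_le)
  with p(1) show ?thesis by linarith
qed

lemma induced_pd_le_edgeless:
  fixes K :: "'k::field itself"
  assumes "\<And>u v. u \<in> W \<Longrightarrow> v \<in> W \<Longrightarrow> \<not> E u v" "0 \<le> s"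
  shows "induced_pd_le K E W s"
proof -
  have "edge_monomials E W = ({} :: (_, 'k) mpoly set)"
    using assms(1) by (auto simp: edge_monomials_def)
  then show ?thesis
    using assms(2) by (auto simp: induced_pd_le_def ideal.has_free_res_0 intro!: exI[of _ 0])
qed

lemma induced_pd_le_mono: "induced_pd_le K E W s \<Longrightarrow> s \<le> t \<Longrightarrow> induced_pd_le K E W t"
  by (auto simp: induced_pd_le_def intro: order_trans)

lemma induced_pd_le_isolated:
  fixes K :: "'k::field itself"
  assumes "simple_graph E" "neighbours E W v = {}" "induced_pd_le K E (W - {v}) s"
  shows "induced_pd_le K E W s"
proof -
  have "edge_monomials E (W - {v}) = (edge_monomials E W :: (_, 'k) mpoly set)"
    using assms(1,2) by (fastforce simp: edge_monomials_def neighbours_def simple_graph_def)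
  with assms(3) show ?thesis by (simp add: induced_pd_le_def)
qed

lemma induced_pd_le_vertex:
  fixes K :: "'k::field itself"
  assumes "simple_graph E" "finite W" "x \<in> W"
    and deletion: "induced_pd_le K E (W - {x}) (s - 1)"
    and link: "induced_pd_le K E (W - insert x (neighbours E W x)) (s - card (neighbours E W x))"
  shows "induced_pd_le K E W s"
proof -
  let ?k = "card (neighbours E W x)"
  from deletion obtain p where p: "real p \<le> s - 1"
      "ideal.has_free_res p (ideal.span (edge_monomials E (W - {x}) :: (_, 'k) mpoly set))"
    by (auto simp: induced_pd_le_def)
  from link obtain q where q: "real q \<le> s - ?k" "ideal.has_free_res q
      (ideal.span (edge_monomials E (W - insert x (neighbours E W x)) :: (_, 'k) mpoly set))"
    by (auto simp: induced_pd_le_def)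
  define r where "r = max p (q + ?k - 1)"
  have "ideal.has_free_res (Suc r) (ideal.span (edge_monomials E W :: (_, 'k) mpoly set))"
  proof (rule ideal_has_free_res_vertex[OF assms(1-3) _ q(2)])
    show "ideal.has_free_res r (ideal.span (edge_monomials E (W - {x}) :: (_, 'k) mpoly set))"
      using p(2) by (rule ideal.has_free_res_mono) (simp add: r_def)
  qed (simp add: r_def)
  moreover have "Suc r = max (Suc p) (q + ?k)"
    by (auto simp: r_def)
  then have "real (Suc r) \<le> s"
    using p(1) q(1) by (simp add: max_def split: if_splits)
  ultimately show ?thesis unfolding induced_pd_le_def by blast
qed

section \<open>Deleting the neighbours of a vertex\<close>

definition independent_set :: "('v \<Rightarrow> 'v \<Rightarrow> bool) \<Rightarrow> 'v set \<Rightarrow> bool" where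
  "independent_set E L \<longleftrightarrow> (\<forall>a\<in>L. \<forall>b\<in>L. \<not> E a b)"

definition non_neighbours :: "('v \<Rightarrow> 'v \<Rightarrow> bool) \<Rightarrow> 'v set \<Rightarrow> 'v \<Rightarrow> 'v set" where
  "non_neighbours E W v = W - insert v (neighbours E W v)"

definition clustered_neighbourhoods :: "real \<Rightarrow> ('v \<Rightarrow> 'v \<Rightarrow> bool) \<Rightarrow> bool" where
  "clustered_neighbourhoods \<alpha> E \<longleftrightarrow>
     (\<forall>v A. A \<noteq> {} \<longrightarrow> A \<subseteq> {w. E v w} \<longrightarrow>
        (\<exists>y\<in>A. real (card (non_neighbours E A y)) \<le> \<alpha> * real (card A)))"

lemma exists_dominating_independent_set:
  assumes "simple_graph E" "finite A"
  obtains L where "L \<subseteq> A" "independent_set E L" "A \<subseteq> (\<Union>y\<in>L. insert y (neighbours E A y))"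
proof -
  let ?I = "{L. L \<subseteq> A \<and> independent_set E L}"
  have "finite ?I" using assms(2) by simp
  moreover have "{} \<in> ?I" by (simp add: independent_set_def)
  ultimately obtain L where L: "L \<in> ?I"
      and max: "\<And>L'. L' \<in> ?I \<Longrightarrow> L \<subseteq> L' \<Longrightarrow> L = L'"
    using finite_has_maximal2[of ?I "{}"] by metis
  have "a \<in> (\<Union>y\<in>L. insert y (neighbours E A y))" if "a \<in> A" for a
  proof (rule ccontr)
    assume a: "a \<notin> (\<Union>y\<in>L. insert y (neighbours E A y))"
    then have "insert a L \<in> ?I"
      using L \<open>a \<in> A\<close> assms(1) by (auto simp: neighbours_def simple_graph_def independent_set_def)
    then have "L = insert a L" by (rule max) auto
    with a show False by auto
  qed
  with L show thesis by (intro that[of L]) auto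
qed

lemma exists_large_closed_neighbourhood:
  assumes "simple_graph E" "finite A" "A \<noteq> {}"
    and independent: "\<And>L. L \<subseteq> A \<Longrightarrow> independent_set E L \<Longrightarrow> card L \<le> m"
  obtains y where "y \<in> A" "card A \<le> m * card (insert y (neighbours E A y))"
proof -
  obtain L where L: "L \<subseteq> A" "independent_set E L" "A \<subseteq> (\<Union>y\<in>L. insert y (neighbours E A y))"
    using assms(1,2) by (rule exists_dominating_independent_set)
  have L_fin: "finite L" "L \<noteq> {}"
    using L(1,3) assms(2,3) finite_subset by auto
  have "\<exists>y\<in>L. card A \<le> m * card (insert y (neighbours E A y))"
  proof (rule ccontr)
    assume "\<not> ?thesis"
    then have small: "m * card (insert y (neighbours E A y)) < card A" if "y \<in> L" for y
      using that by force
    have "finite (\<Union>y\<in>L. insert y (neighbours E A y))"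
      using L_fin(1) assms(2) by simp
    then have "card A \<le> card (\<Union>y\<in>L. insert y (neighbours E A y))"
      using L(3) by (rule card_mono)
    also have "\<dots> \<le> (\<Sum>y\<in>L. card (insert y (neighbours E A y)))"
      by (rule card_UN_le[OF L_fin(1)])
    finally have "m * card A \<le> (\<Sum>y\<in>L. m * card (insert y (neighbours E A y)))"
      by (simp flip: sum_distrib_left)
    also have "\<dots> < (\<Sum>y\<in>L. card A)"
      using L_fin small by (rule sum_strict_mono)
    also have "\<dots> \<le> m * card A"
      using independent[OF L(1,2)] by simp
    finally show False by simp
  qed
  with L(1) show thesis using that by blast
qed

lemma card_independent_neighbours_le:
  assumes "simple_graph E" "\<not> has_induced_star E (m + 1)"
    and "L \<subseteq> {w. E v w}" "independent_set E L"
  shows "card L \<le> m"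
proof (rule ccontr)
  assume "\<not> card L \<le> m"
  then have "m + 1 \<le> card L" by simp
  then obtain L' where L': "L' \<subseteq> L" "card L' = m + 1" "finite L'"
    by (rule obtain_subset_with_card_n)
  have leaves: "\<forall>l\<in>L'. E v l"
    using L'(1) assms(3) by blast
  moreover have "v \<notin> L'"
    using leaves assms(1) unfolding simple_graph_def by blast
  moreover have "\<forall>a\<in>L'. \<forall>b\<in>L'. \<not> E a b"
    using L'(1) assms(4) unfolding independent_set_def by blast
  ultimately show False
    using assms(2) L'(2,3) unfolding has_induced_star_def by blast
qed

lemma clustered_neighbourhoods_of_no_induced_star:
  fixes E :: "'v::finite \<Rightarrow> 'v \<Rightarrow> bool"
  assumes "simple_graph E" "m \<ge> 1" "\<not> has_induced_star E (m + 1)"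
  shows "clustered_neighbourhoods ((real m - 1) / real m) E"
  unfolding clustered_neighbourhoods_def
proof (intro allI impI)
  fix v and A :: "'v set"
  assume A: "A \<noteq> {}" "A \<subseteq> {w. E v w}"
  have "card L \<le> m" if "L \<subseteq> A" "independent_set E L" for L
    using assms(1,3) _ that(2) by (rule card_independent_neighbours_le) (use A(2) that(1) in blast)
  then obtain y where y: "y \<in> A" "card A \<le> m * card (insert y (neighbours E A y))"
    using assms(1) A(1) by (elim exists_large_closed_neighbourhood[rotated -1]) auto
  have "insert y (neighbours E A y) \<subseteq> A"
    using y(1) by (auto simp: neighbours_def)
  then have "real (card (non_neighbours E A y)) =
      real (card A) - real (card (insert y (neighbours E A y)))"
    by (simp add: non_neighbours_def card_Diff_subset card_mono of_nat_diff)
  also have "\<dots> \<le> (real m - 1) / real m * real (card A)"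
  proof -
    have "real (card A) \<le> real m * real (card (insert y (neighbours E A y)))"
      using y(2) by (metis of_nat_le_iff of_nat_mult)
    then show ?thesis using assms(2) by (simp add: field_simps)
  qed
  finally show "\<exists>y\<in>A. real (card (non_neighbours E A y)) \<le> (real m - 1) / real m * real (card A)"
    using y(1) by blast
qed

lemma card_neighbours_le_deg: "card (neighbours E W v) \<le> deg E v"
  unfolding neighbours_def deg_def by (rule card_mono) auto

lemma card_add_degree_outside:
  assumes "simple_graph E" "finite W" "A \<subseteq> W" "y \<in> A"
  shows "card A + card (neighbours E (W - (A - {y})) y) =
    Suc (card (non_neighbours E A y)) + card (neighbours E W y)"
proof -
  let ?N = "neighbours E A y" and ?U = "W - (A - {y})"
  have "finite A" using assms(3,2) by (rule finite_subset)
  with assms(2) have fin: "finite A" "finite ?N" "finite (neighbours E ?U y)" by auto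
  have "insert y ?N \<subseteq> A" "y \<notin> ?N"
    using assms(1,4) by (auto simp: neighbours_def simple_graph_def)
  then have "card A = card (non_neighbours E A y) + Suc (card ?N)"
    using fin card_mono[of A "insert y ?N"] by (simp add: non_neighbours_def card_Diff_subset)
  moreover have "neighbours E W y = ?N \<union> neighbours E ?U y" "?N \<inter> neighbours E ?U y = {}"
    using assms(1,3) by (auto simp: neighbours_def simple_graph_def)
  then have "card (neighbours E W y) = card ?N + card (neighbours E ?U y)"
    using fin by (simp add: card_Un_disjoint)
  ultimately show ?thesis by simp
qed

lemma induced_pd_le_of_fewer_vertices:
  fixes D :: real
  assumes "induced_pd_le K E U (real (card U) * (1 - 1 / D))"
    and "card W = card U + k" "real k \<le> D" "D \<ge> 1"
  shows "induced_pd_le K E U (real (card W) * (1 - 1 / D) - (real k - 1))"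
proof (rule induced_pd_le_mono[OF assms(1)])
  have "real (card W) * (1 - 1 / D) - (real k - 1) = real (card U) * (1 - 1 / D) + (1 - real k / D)"
    using assms(4) unfolding assms(2) by (simp add: field_simps)
  also have "\<dots> \<ge> real (card U) * (1 - 1 / D)"
    using assms(3,4) by simp
  finally show "real (card U) * (1 - 1 / D) \<le> real (card W) * (1 - 1 / D) - (real k - 1)" .
qed

lemma induced_pd_le_delete_neighbours:
  fixes D :: real
  assumes "simple_graph E" "finite W" "v \<in> W" "D \<ge> 1"
    and degree: "real (card (neighbours E W v)) + 1 \<le> D"
    and smaller: "\<And>U. U \<subset> W \<Longrightarrow> induced_pd_le K E U (real (card U) * (1 - 1 / D))"
  shows "induced_pd_le K E (W - neighbours E W v)
    (real (card W) * (1 - 1 / D) - real (card (neighbours E W v)))"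
proof (rule induced_pd_le_isolated[OF assms(1)])
  let ?N = "neighbours E W v"
  have N: "insert v ?N \<subseteq> W" "v \<notin> ?N" "finite ?N"
    using assms(1-3) by (auto simp: neighbours_def simple_graph_def)
  show "neighbours E (W - ?N) v = {}"
    by (auto simp: neighbours_def)
  have "card W = card (W - insert v ?N) + (card ?N + 1)"
    using N assms(2) card_mono[OF assms(2) N(1)] by (simp add: card_Diff_subset)
  then have "induced_pd_le K E (W - insert v ?N)
      (real (card W) * (1 - 1 / D) - (real (card ?N + 1) - 1))"
    using assms(3,4) degree by (intro induced_pd_le_of_fewer_vertices smaller) auto
  moreover have "W - ?N - {v} = W - insert v ?N" by auto
  ultimately show "induced_pd_le K E (W - ?N - {v}) (real (card W) * (1 - 1 / D) - real (card ?N))"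
    by simp
qed

lemma induced_pd_le_restore_neighbour:
  fixes D :: real
  assumes "simple_graph E" "finite W" "A \<subseteq> W" "y \<in> A" "D \<ge> 1"
    and degree: "real (card (non_neighbours E A y)) + real (card (neighbours E W y)) + 1 \<le> D"
    and smaller: "\<And>U. U \<subset> W \<Longrightarrow> induced_pd_le K E U (real (card U) * (1 - 1 / D))"
    and deleted: "induced_pd_le K E (W - A) (real (card W) * (1 - 1 / D) - real (card A))"
  shows "induced_pd_le K E (W - (A - {y})) (real (card W) * (1 - 1 / D) - real (card (A - {y})))"
proof (rule induced_pd_le_vertex[OF assms(1)])
  let ?U = "W - (A - {y})"
  let ?K = "neighbours E ?U y"
  show "finite ?U" "y \<in> ?U" using assms(2-4) by auto
  have "finite A" using assms(3,2) by (rule finite_subset)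
  with assms(2) have fin: "finite A" "finite ?K" by auto
  have card_A: "real (card A) = real (card (A - {y})) + 1"
    using fin(1) assms(4) card_Suc_Diff1[of A y] by simp
  have "?U - {y} = W - A" using assms(3,4) by auto
  then show "induced_pd_le K E (?U - {y}) (real (card W) * (1 - 1 / D) - real (card (A - {y})) - 1)"
    using deleted by (simp add: card_A algebra_simps)
  have "A \<inter> ?K = {}" "A \<union> ?K \<subseteq> W" and remaining: "?U - insert y ?K = W - (A \<union> ?K)"
    using assms(1,3,4) by (auto simp: neighbours_def simple_graph_def)
  then have "card W = card (W - (A \<union> ?K)) + (card A + card ?K)"
    using fin assms(2) card_mono[of W "A \<union> ?K"] by (simp add: card_Diff_subset card_Un_disjoint)
  moreover have "real (card A + card ?K) \<le> D"
    using degree card_add_degree_outside[OF assms(1-4)] by simp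
  moreover have "W - (A \<union> ?K) \<subset> W" using assms(3,4) by auto
  ultimately have "induced_pd_le K E (W - (A \<union> ?K))
      (real (card W) * (1 - 1 / D) - (real (card A + card ?K) - 1))"
    using assms(5) by (intro induced_pd_le_of_fewer_vertices smaller)
  then show "induced_pd_le K E (?U - insert y ?K)
      (real (card W) * (1 - 1 / D) - real (card (A - {y})) - real (card ?K))"
    unfolding remaining by (simp add: card_A algebra_simps)
qed

lemma finite_descend_to_empty:
  assumes "finite A" "P A" "\<And>B. B \<subseteq> A \<Longrightarrow> B \<noteq> {} \<Longrightarrow> P B \<Longrightarrow> \<exists>y\<in>B. P (B - {y})"
  shows "P {}"
  using assms
proof (induction rule: finite_psubset_induct)
  case (psubset A)
  show ?case
  proof (cases "A = {}")
    case True
    with psubset.prems(1) show ?thesis by simp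
  next
    case False
    with psubset.prems obtain y where y: "y \<in> A" "P (A - {y})" by blast
    show ?thesis
    proof (rule psubset.IH)
      show "A - {y} \<subset> A" using y(1) by blast
    qed (use y psubset.prems(2) in auto)
  qed
qed

lemma induced_pd_le_non_isolated_vertex:
  fixes E :: "'v::finite \<Rightarrow> 'v \<Rightarrow> bool" and D :: real
  assumes E: "simple_graph E" and clustered: "clustered_neighbourhoods \<alpha> E" and "\<alpha> \<ge> 0" "D \<ge> 1"
    and edges: "\<And>u w. E u w \<Longrightarrow> real (deg E u) + \<alpha> * real (deg E w) + 1 \<le> D"
    and "v \<in> W" "E v w"
    and smaller: "\<And>U. U \<subset> W \<Longrightarrow> induced_pd_le K E U (real (card U) * (1 - 1 / D))"
  shows "induced_pd_le K E W (real (card W) * (1 - 1 / D))"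
proof -
  let ?N = "neighbours E W v"
  let ?P = "\<lambda>A. induced_pd_le K E (W - A) (real (card W) * (1 - 1 / D) - real (card A))"
  have "real (deg E v) + 1 \<le> D"
    using edges[OF \<open>E v w\<close>] mult_nonneg_nonneg[OF \<open>\<alpha> \<ge> 0\<close>, of "real (deg E w)"] by simp
  then have "?P ?N"
    using card_neighbours_le_deg[of E W v] E \<open>D \<ge> 1\<close> \<open>v \<in> W\<close> smaller
    by (intro induced_pd_le_delete_neighbours) auto
  have restore: "\<exists>y\<in>A. ?P (A - {y})" if A: "A \<subseteq> ?N" "A \<noteq> {}" "?P A" for A
  proof -
    have "A \<subseteq> {w. E v w}" using A(1) by (auto simp: neighbours_def)
    with clustered A(2) obtain y where y: "y \<in> A"
        "real (card (non_neighbours E A y)) \<le> \<alpha> * real (card A)"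
      unfolding clustered_neighbourhoods_def by blast
    have "E y v" using E y(1) A(1) by (auto simp: neighbours_def simple_graph_def)
    have "card A \<le> deg E v"
      using card_mono[OF _ A(1)] card_neighbours_le_deg[of E W v] by simp
    then have "\<alpha> * real (card A) \<le> \<alpha> * real (deg E v)"
      using \<open>\<alpha> \<ge> 0\<close> by (intro mult_left_mono) auto
    then have "real (card (non_neighbours E A y)) + real (card (neighbours E W y)) + 1 \<le> D"
      using y(2) edges[OF \<open>E y v\<close>] card_neighbours_le_deg[of E W y] by simp
    moreover have "A \<subseteq> W" using A(1) by (auto simp: neighbours_def)
    ultimately have "?P (A - {y})"
      using E \<open>D \<ge> 1\<close> y(1) A(3) smaller by (intro induced_pd_le_restore_neighbour) auto
    with y(1) show ?thesis by blast
  qed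
  with \<open>?P ?N\<close> have "?P {}"
    by (intro finite_descend_to_empty[of ?N ?P]) auto
  then show ?thesis by simp
qed

theorem induced_pd_le_of_clustered_neighbourhoods:
  fixes E :: "'v::finite \<Rightarrow> 'v \<Rightarrow> bool" and D :: real
  assumes "simple_graph E" "clustered_neighbourhoods \<alpha> E" "\<alpha> \<ge> 0" "D \<ge> 1"
    and "\<And>u w. E u w \<Longrightarrow> real (deg E u) + \<alpha> * real (deg E w) + 1 \<le> D"
  shows "induced_pd_le K E W (real (card W) * (1 - 1 / D))"
proof (induction W rule: finite_psubset_induct[OF finite])
  case (1 W)
  show ?case
  proof (cases "\<exists>v\<in>W. \<exists>w\<in>W. E v w")
    case True
    then obtain v w where vw: "v \<in> W" "E v w" by blast
    show ?thesis
    proof (rule induced_pd_le_non_isolated_vertex[OF assms(1-4) _ vw])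
      show "real (deg E a) + \<alpha> * real (deg E b) + 1 \<le> D" if "E a b" for a b
        using that by (rule assms(5))
      show "induced_pd_le K E U (real (card U) * (1 - 1 / D))" if "U \<subset> W" for U
        using that by (rule 1)
    qed
  next
    case False
    then show ?thesis
      using assms(4) by (intro induced_pd_le_edgeless) auto
  qed
qed

theorem theorem3p6:
  fixes E :: "'v::finite \<Rightarrow> 'v \<Rightarrow> bool" and m :: nat and x y :: 'v
  assumes "simple_graph E"
    and "m \<ge> 1"
    and "\<not> has_induced_star E (m + 1)"
    and "alpha_max_edge ((real m - 1) / real m) E x y"
    and "deg E x \<ge> deg E y"
  shows "real (pd_graph E TYPE('k::field)) \<le>
    real (card (UNIV :: 'v set)) * (1 - 1 / (real (deg E x) + (real m - 1) / real m * real (deg E y) + 1))"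
proof (intro pd_graph_le induced_pd_le_of_clustered_neighbourhoods)
  show "clustered_neighbourhoods ((real m - 1) / real m) E"
    using assms(1-3) by (rule clustered_neighbourhoods_of_no_induced_star)
  show "0 \<le> (real m - 1) / real m"
    "1 \<le> real (deg E x) + (real m - 1) / real m * real (deg E y) + 1"
    using assms(2) by simp_all
  show "real (deg E u) + (real m - 1) / real m * real (deg E w) + 1 \<le>
      real (deg E x) + (real m - 1) / real m * real (deg E y) + 1" if "E u w" for u w
    using assms(4) that by (simp add: alpha_max_edge_def)
qed (fact assms(1))

end
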